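(* Let $G$ be a connected bicyclic graph on $n$ vertices of type-I containing cycles of length $t\ge s\ge3$, and let $\mathbf{X}_G=\sum_{\lambda\vdash n}c_\lambda\,\mathfrak{st}_\lambda$ be its star-expansion. Then for $j\ge1$, \[\sum_{\substack{\lambda\vdash n\\ \ell(\lambda)=j}}c_\lambda=(-1)^{j-1}\sum_{i=1}^{j}\binom{s-1}{i}\binom{t-1}{j-i+1}=(-1)^{j-1}\left[\binom{s+t-2}{j+1}-\binom{t-1}{j+1}-\binom{s-1}{j+1}\right].\] In particular, the sum vanishes when $j\ge s+t-2$ and is non-zero for $1\le j\le s+t-3$.
   Context: All graphs are finite and simple. The chromatic symmetric function of a graph $G$ with vertices $v_1,\dots,v_n$ is $\mathbf{X}_G=\sum_\kappa x_{\kappa(v_1)}\cdots x_{\kappa(v_n)}$, summed over all proper colorings $\kappa:V(G)\to\mathbb{N}$. The star graph $\mathsf{St}_k$ on $k$ vertices is the tree with one central vertex adjacent to $k-1$ leaves ($\mathsf{St}_1$ is a single vertex); $\mathfrak{st}_k:=\mathbf{X}_{\mathsf{St}_k}$, and $\mathfrak{st}_\lambda:=\mathfrak{st}_{\lambda_1}\mathfrak{st}_{\lambda_2}\cdots$ for a partition $\lambda$. The set $\{\mathfrak{st}_\lambda:\lambda\vdash n\}$ is a $\mathbb{Q}$-basis (the star-basis) of the space of homogeneous symmetric functions of degree $n$, so $\mathbf{X}_G=\sum_{\lambda\vdash n}c_\lambda\mathfrak{st}_\lambda$ with uniquely determined coefficients $c_\lambda$. $\ell(\lambda)$ denotes the number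 of parts of $\lambda$. A bicyclic graph is a simple connected graph whose number of edges equals its number of vertices plus one. It is of type-I if its unique minimal bicyclic subgraph consists of two cycles $C_s$ and $C_t$ joined by a path on $h\ge1$ vertices from a vertex of $C_s$ to a vertex of $C_t$ (for $h=1$ the two cycles share exactly one vertex); i.e. its two cycles share at most one vertex. Binomial coefficients $\binom ab$ with $a\ge 0$ are $0$ when $b<0$ or $b>a$. *)

theory Defs
  imports Complex_Main "HOL-Library.FuncSet" "HOL-Library.Multiset" "HOL-Library.Poly_Mapping"
begin

section \<open>Formal power series in the variables \<open>x\<^sub>0, x\<^sub>1, x\<^sub>2, \<dots>\<close>\<close>

text \<open>
  A monomial \<open>\<Prod>\<^sub>i x\<^sub>i ^ (m i)\<close> is encoded by its finitely supported exponent
  vector \<open>m :: nat \<Rightarrow>\<^sub>0 nat\<close>, so that multiplication of monomials is addition of exponent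
  vectors.  A power series is an arbitrary assignment of coefficients to monomials, with
  the Cauchy product as multiplication.
\<close>

typedef 'a mfps = "UNIV :: ((nat \<Rightarrow>\<^sub>0 nat) \<Rightarrow> 'a) set"
  morphisms coeff_mfps Abs_mfps
  by simp

setup_lifting type_definition_mfps

lemma finite_splittings: "finite {(a, b). a + b = (m :: nat \<Rightarrow>\<^sub>0 nat)}"
proof -
  let ?D = "{a :: nat \<Rightarrow>\<^sub>0 nat. \<forall>i. Poly_Mapping.lookup a i \<le> Poly_Mapping.lookup m i}"
  let ?B = "Max (range (Poly_Mapping.lookup m))"
  have "finite (range (Poly_Mapping.lookup m))"
  proof (rule finite_subset)
    show "range (Poly_Mapping.lookup m) \<subseteq> insert 0 (Poly_Mapping.lookup m ` Poly_Mapping.keys m)"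
      by (auto simp: in_keys_iff)
  qed simp
  then have le: "Poly_Mapping.lookup m i \<le> ?B" for i by (intro Max_ge) auto
  have "Poly_Mapping.lookup ` ?D \<subseteq> {f. \<forall>i. (i \<in> Poly_Mapping.keys m \<longrightarrow> f i \<in> {..?B}) \<and> (i \<notin> Poly_Mapping.keys m \<longrightarrow> f i = 0)}"
  proof safe
    fix a i
    assume a: "\<forall>i. Poly_Mapping.lookup a i \<le> Poly_Mapping.lookup m i"
    show "Poly_Mapping.lookup a i \<le> ?B" using a le order_trans by blast
    show "Poly_Mapping.lookup a i = 0" if "i \<notin> Poly_Mapping.keys m"
      using a that by (metis in_keys_iff le_zero_eq)
  qed
  then have "finite (Poly_Mapping.lookup ` ?D)"
    by (rule finite_subset) (rule finite_set_of_finite_funs, auto)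
  then have "finite ?D"
    by (rule finite_imageD) (simp add: inj_on_def poly_mapping_eqI)
  moreover have "{(a, b). a + b = m} \<subseteq> ?D \<times> ?D"
    by (auto simp: lookup_add)
  ultimately show ?thesis
    by (meson finite_SigmaI finite_subset)
qed

instantiation mfps :: (comm_ring_1) comm_ring_1
begin

lift_definition zero_mfps :: "'a mfps" is "\<lambda>_. 0" .
lift_definition one_mfps :: "'a mfps" is "\<lambda>m. if m = 0 then 1 else 0" .
lift_definition plus_mfps :: "'a mfps \<Rightarrow> 'a mfps \<Rightarrow> 'a mfps" is "\<lambda>f g m. f m + g m" .
lift_definition minus_mfps :: "'a mfps \<Rightarrow> 'a mfps \<Rightarrow> 'a mfps" is "\<lambda>f g m. f m - g m" .
lift_definition uminus_mfps :: "'a mfps \<Rightarrow> 'a mfps" is "\<lambda>f m. - f m" .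
lift_definition times_mfps :: "'a mfps \<Rightarrow> 'a mfps \<Rightarrow> 'a mfps"
  is "\<lambda>f g m. \<Sum>(a, b) | a + b = m. f a * g b" .

instance
proof
  fix f g h :: "'a mfps"
  show "f + g + h = f + (g + h)" by transfer (simp add: add.assoc)
  show "f + g = g + f" by transfer (simp add: add.commute)
  show "0 + f = f" by transfer simp
  show "- f + f = 0" by transfer simp
  show "f - g = f + - g" by transfer simp
  show "(0 :: 'a mfps) \<noteq> 1" by transfer (metis zero_neq_one)
  show "(f + g) * h = f * h + g * h"
    by transfer (simp add: sum.distrib distrib_right case_prod_unfold)
  show "f * g = g * f"
  proof (transfer, rule ext)
    fix f g :: "(nat \<Rightarrow>\<^sub>0 nat) \<Rightarrow> 'a" and m
    show "(\<Sum>(a, b) | a + b = m. f a * g b) = (\<Sum>(a, b) | a + b = m. g a * f b)"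
      by (rule sum.reindex_bij_witness[where i = prod.swap and j = prod.swap])
         (auto simp: add.commute mult.commute)
  qed
  show "1 * f = f"
  proof (transfer, rule ext)
    fix f :: "(nat \<Rightarrow>\<^sub>0 nat) \<Rightarrow> 'a" and m
    have "(\<Sum>(a, b) | a + b = m. (if a = 0 then 1 else 0) * f b)
        = (\<Sum>(a, b) \<in> {(0 :: nat \<Rightarrow>\<^sub>0 nat, m)}. (if a = 0 then 1 else 0) * f b)"
      by (rule sum.mono_neutral_right[OF finite_splittings]) (auto split: if_splits)
    then show "(\<Sum>(a, b) | a + b = m. (if a = 0 then 1 else 0) * f b) = f m"
      by simp
  qed
  show "f * g * h = f * (g * h)"
  proof (transfer, rule ext)
    fix f g h :: "(nat \<Rightarrow>\<^sub>0 nat) \<Rightarrow> 'a" and m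
    let ?S = "\<lambda>m :: nat \<Rightarrow>\<^sub>0 nat. {(a, b). a + b = m}"
    have "(\<Sum>(a, b) \<in> ?S m. (\<Sum>(c, d) \<in> ?S a. f c * g d) * h b)
        = (\<Sum>p \<in> ?S m. \<Sum>q \<in> ?S (fst p). f (fst q) * g (snd q) * h (snd p))"
      by (simp add: case_prod_unfold sum_distrib_right)
    also have "\<dots> = (\<Sum>(p, q) \<in> Sigma (?S m) (\<lambda>p. ?S (fst p)). f (fst q) * g (snd q) * h (snd p))"
      by (rule sum.Sigma) (use finite_splittings in auto)
    also have "\<dots> = (\<Sum>(p, q) \<in> Sigma (?S m) (\<lambda>p. ?S (snd p)). f (fst p) * (g (fst q) * h (snd q)))"
      by (rule sum.reindex_bij_witness
            [where j = "\<lambda>((a, b), (c, d)). ((c, d + b), (d, b))"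
               and i = "\<lambda>((a, b), (c, d)). ((a + c, d), (a, c))"])
         (auto simp: add.assoc mult.assoc)
    also have "\<dots> = (\<Sum>p \<in> ?S m. \<Sum>q \<in> ?S (snd p). f (fst p) * (g (fst q) * h (snd q)))"
      by (rule sum.Sigma[symmetric]) (use finite_splittings in auto)
    also have "\<dots> = (\<Sum>(a, b) \<in> ?S m. f a * (\<Sum>(c, d) \<in> ?S b. g c * h d))"
      by (simp add: case_prod_unfold sum_distrib_left)
    finally show "(\<Sum>(a, b) \<in> ?S m. (\<Sum>(c, d) \<in> ?S a. f c * g d) * h b)
        = (\<Sum>(a, b) \<in> ?S m. f a * (\<Sum>(c, d) \<in> ?S b. g c * h d))" .
  qed
qed

end

lift_definition scale_mfps :: "'a :: comm_ring_1 \<Rightarrow> 'a mfps \<Rightarrow> 'a mfps"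
  is "\<lambda>c f m. c * f m" .


section \<open>Graphs\<close>

text \<open>A graph is a pair of a vertex set and a set of two-element sets of vertices.\<close>

type_synonym 'v graph = "'v set \<times> 'v set set"

abbreviation verts :: "'v graph \<Rightarrow> 'v set" where "verts \<equiv> fst"
abbreviation edges :: "'v graph \<Rightarrow> 'v set set" where "edges \<equiv> snd"

definition simple_graph :: "'v graph \<Rightarrow> bool" where
  "simple_graph G \<longleftrightarrow> finite (verts G) \<and> (\<forall>e \<in> edges G. e \<subseteq> verts G \<and> card e = 2)"

definition connected_graph :: "'v graph \<Rightarrow> bool" where
  "connected_graph G \<longleftrightarrow> verts G \<noteq> {} \<and>
     (\<forall>u \<in> verts G. \<forall>v \<in> verts G. (u, v) \<in> {(x, y). {x, y} \<in> edges G}\<^sup>*)"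

definition bicyclic :: "'v graph \<Rightarrow> bool" where
  "bicyclic G \<longleftrightarrow> simple_graph G \<and> connected_graph G \<and> card (edges G) = card (verts G) + 1"

definition subgraph :: "'v graph \<Rightarrow> 'v graph \<Rightarrow> bool" where
  "subgraph H G \<longleftrightarrow> simple_graph H \<and> verts H \<subseteq> verts G \<and> edges H \<subseteq> edges G"

definition minimal_bicyclic_subgraph :: "'v graph \<Rightarrow> 'v graph \<Rightarrow> bool" where
  "minimal_bicyclic_subgraph H G \<longleftrightarrow> subgraph H G \<and> bicyclic H \<and>
     (\<forall>H'. subgraph H' H \<and> bicyclic H' \<longrightarrow> H' = H)"

definition path_edges :: "'v list \<Rightarrow> 'v set set" where
  "path_edges p = {{p ! i, p ! (i + 1)} | i. i + 1 < length p}"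

definition cycle_edges :: "'v list \<Rightarrow> 'v set set" where
  "cycle_edges p = {{p ! i, p ! ((i + 1) mod length p)} | i. i < length p}"

text \<open>
  \<open>H\<close> consists of a cycle \<open>C\<close> of length \<open>s\<close> and a cycle \<open>D\<close> of length \<open>t\<close>, joined by a path
  \<open>P\<close> on at least one vertex that starts on \<open>C\<close>, ends on \<open>D\<close>, and otherwise avoids both.  If
  \<open>P\<close> has a single vertex, that vertex is the only common vertex of \<open>C\<close> and \<open>D\<close>; otherwise \<open>C\<close>
  and \<open>D\<close> are disjoint.
\<close>

definition two_joined_cycles :: "nat \<Rightarrow> nat \<Rightarrow> 'v graph \<Rightarrow> bool" where
  "two_joined_cycles s t H \<longleftrightarrow> (\<exists>C D P.
     distinct C \<and> length C = s \<and> s \<ge> 3 \<and>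
     distinct D \<and> length D = t \<and> t \<ge> 3 \<and>
     distinct P \<and> length P \<ge> 1 \<and>
     set P \<inter> set C = {hd P} \<and> set P \<inter> set D = {last P} \<and>
     set C \<inter> set D = (if length P = 1 then {hd P} else {}) \<and>
     verts H = set C \<union> set D \<union> set P \<and>
     edges H = cycle_edges C \<union> cycle_edges D \<union> path_edges P)"

definition bicyclic_type_I :: "nat \<Rightarrow> nat \<Rightarrow> 'v graph \<Rightarrow> bool" where
  "bicyclic_type_I s t G \<longleftrightarrow> bicyclic G \<and>
     (\<exists>H. minimal_bicyclic_subgraph H G \<and> two_joined_cycles s t H)"

definition star_graph :: "nat \<Rightarrow> nat graph" where
  "star_graph k = ({0..<k}, {{0, i} | i. 1 \<le> i \<and> i < k})"


section \<open>Chromatic symmetric functions and star-expansions\<close>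

text \<open>
  Colorings are extensional functions, so that each coloring of the vertex set is counted
  exactly once.
\<close>

definition proper_colorings :: "'v graph \<Rightarrow> ('v \<Rightarrow> nat) set" where
  "proper_colorings G = {\<kappa> \<in> verts G \<rightarrow>\<^sub>E UNIV.
     \<forall>u \<in> verts G. \<forall>v \<in> verts G. {u, v} \<in> edges G \<longrightarrow> \<kappa> u \<noteq> \<kappa> v}"

text \<open>
  The coefficient of a monomial in \<open>\<Sum>\<^sub>\<kappa> x\<^bsub>\<kappa>(v\<^sub>1)\<^esub> \<cdots> x\<^bsub>\<kappa>(v\<^sub>n)\<^esub>\<close> is the number of proper
  colorings \<open>\<kappa>\<close> whose product of variables is that monomial.  For a finite vertex set this
  number is finite.
\<close>

lift_definition chromatic_symfun :: "'v graph \<Rightarrow> rat mfps" is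
  "\<lambda>G m. of_nat (card {\<kappa> \<in> proper_colorings G. (\<Sum>v \<in> verts G. Poly_Mapping.single (\<kappa> v) 1) = m})" .

lemma finite_colorings_of_monomial:
  assumes "finite (verts G)"
  shows "finite {\<kappa> \<in> proper_colorings G. (\<Sum>v \<in> verts G. Poly_Mapping.single (\<kappa> v) (1::nat)) = m}"
proof (rule finite_subset)
  show "{\<kappa> \<in> proper_colorings G. (\<Sum>v \<in> verts G. Poly_Mapping.single (\<kappa> v) 1) = m}
      \<subseteq> verts G \<rightarrow>\<^sub>E Poly_Mapping.keys m"
  proof (safe intro!: PiE_I)
    fix \<kappa> v
    assume v: "v \<in> verts G"
    have "Poly_Mapping.lookup (Poly_Mapping.single (\<kappa> v) 1) (\<kappa> v)
        \<le> (\<Sum>w \<in> verts G. Poly_Mapping.lookup (Poly_Mapping.single (\<kappa> w) (1::nat)) (\<kappa> v))"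
      using assms v by (intro member_le_sum) auto
    then show "\<kappa> v \<in> Poly_Mapping.keys (\<Sum>v \<in> verts G. Poly_Mapping.single (\<kappa> v) (1::nat))"
      by (simp add: in_keys_iff lookup_sum)
  qed (auto simp: proper_colorings_def)
  show "finite (verts G \<rightarrow>\<^sub>E Poly_Mapping.keys m)"
    using assms by (intro finite_PiE) auto
qed

definition star_symfun :: "nat \<Rightarrow> rat mfps" where
  "star_symfun k = chromatic_symfun (star_graph k)"

text \<open>
  A partition is the multiset of its (positive) parts; its number of parts is the size of
  the multiset.
\<close>

definition partitions_of :: "nat \<Rightarrow> nat multiset set" where
  "partitions_of n = {\<mu>. 0 \<notin># \<mu> \<and> sum_mset \<mu> = n}"

lemma finite_partitions_of: "finite (partitions_of n)"
proof (rule finite_subset)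
  show "partitions_of n \<subseteq> (\<Union>k \<in> {..n}. multisets_of_size {..n} k)"
  proof
    fix \<mu> assume mu: "\<mu> \<in> partitions_of n"
    have "0 \<notin># M \<Longrightarrow> size M \<le> sum_mset M" for M :: "nat multiset"
      by (induction M) auto
    moreover have "x \<in># M \<Longrightarrow> x \<le> sum_mset M" for x and M :: "nat multiset"
      by (induction M) auto
    ultimately show "\<mu> \<in> (\<Union>k \<in> {..n}. multisets_of_size {..n} k)"
      using mu by (auto simp: partitions_of_def multisets_of_size_def)
  qed
  show "finite (\<Union>k \<in> {..n}. multisets_of_size {..n} k)"
    by (intro finite_UN_I finite_multisets_of_size) auto
qed

definition star_symfun_partition :: "nat multiset \<Rightarrow> rat mfps" where
  "star_symfun_partition \<mu> = (\<Prod>k \<in># \<mu>. star_symfun k)"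

definition star_expansion :: "'v graph \<Rightarrow> (nat multiset \<Rightarrow> rat) \<Rightarrow> bool" where
  "star_expansion G c \<longleftrightarrow> chromatic_symfun G =
     (\<Sum>\<mu> \<in> partitions_of (card (verts G)). scale_mfps (c \<mu>) (star_symfun_partition \<mu>))"

end

theory Submission
  imports Defs "HOL-Computational_Algebra.Formal_Power_Series"
    "HOL-Computational_Algebra.Polynomial"
begin

text \<open>
  Setting \<open>q\<close> of the variables to \<open>1\<close> and the others to \<open>0\<close> turns \<open>X\<^sub>G\<close> into the chromatic polynomial
  \<open>\<chi>\<^sub>G(q)\<close> and \<open>st\<^sub>k\<close> into \<open>q (q - 1)^(k - 1)\<close>, so that
  \<open>\<chi>\<^sub>G(q) = \<Sum>\<^sub>\<lambda> c\<^sub>\<lambda> q^\<ell>(\<lambda>) (q - 1)^(n - \<ell>(\<lambda>))\<close>.  After division by \<open>(q - 1)^n\<close> this is a polynomial in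
  \<open>y = q / (q - 1)\<close> whose coefficients are the sums over partitions of fixed length.  For a type-I
  bicyclic graph, \<open>\<chi>\<^sub>G(q) = \<chi>\<^bsub>C\<^sub>s\<^esub>(q) \<chi>\<^bsub>C\<^sub>t\<^esub>(q) (q - 1)^(n - s - t + 1) / q\<close> with
  \<open>\<chi>\<^bsub>C\<^sub>k\<^esub>(q) = (q - 1)^k + (-1)^k (q - 1)\<close>, and the polynomial becomes
  \<open>(1 - (1 - y)^(s - 1)) (1 - (1 - y)^(t - 1)) / y\<close>.
\<close>

section \<open>Counting colorings with a bounded number of colors\<close>

text \<open>The cardinality is the value at \<open>q\<close> of the chromatic polynomial of
  \<open>G\<close>; these values stand in for the polynomial throughout.\<close>

definition colorings_below :: "nat \<Rightarrow> 'v graph \<Rightarrow> ('v \<Rightarrow> nat) set" where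
  "colorings_below q G = {\<kappa> \<in> proper_colorings G. \<kappa> ` verts G \<subseteq> {..<q}}"

lemma finite_colorings_below:
  assumes "finite (verts G)"
  shows "finite (colorings_below q G)"
proof (rule finite_subset)
  show "colorings_below q G \<subseteq> verts G \<rightarrow>\<^sub>E {..<q}"
    by (auto simp: colorings_below_def proper_colorings_def PiE_iff extensional_def)
qed (use assms in \<open>auto intro: finite_PiE\<close>)

lemma card_colorings_below_add_vertex:
  assumes V: "finite V" and E: "\<And>e. e \<in> E \<Longrightarrow> e \<subseteq> V" and v: "v \<notin> V" and S: "S \<subseteq> V"
  shows "card (colorings_below q (insert v V, E \<union> (\<lambda>s. {s, v}) ` S))
      = (\<Sum>\<kappa>\<in>colorings_below q (V, E). q - card (\<kappa> ` S))"
proof -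
  let ?C = "colorings_below q (V, E)"
  let ?D = "colorings_below q (insert v V, E \<union> (\<lambda>s. {s, v}) ` S)"
  let ?P = "SIGMA \<kappa>:?C. {..<q} - \<kappa> ` S"
  have "bij_betw (\<lambda>(\<kappa>, x). \<kappa>(v := x)) ?P ?D"
  proof (rule bij_betw_byWitness[where f' = "\<lambda>\<kappa>. (restrict \<kappa> V, \<kappa> v)"])
    show "\<forall>p\<in>?P. (\<lambda>\<kappa>. (restrict \<kappa> V, \<kappa> v)) ((\<lambda>(\<kappa>, x). \<kappa>(v := x)) p) = p"
      using v by (auto simp: colorings_below_def proper_colorings_def restrict_def PiE_iff
          extensional_def fun_eq_iff)
    show "\<forall>\<kappa>\<in>?D. (\<lambda>(\<kappa>, x). \<kappa>(v := x)) (restrict \<kappa> V, \<kappa> v) = \<kappa>"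
      by (auto simp: colorings_below_def proper_colorings_def restrict_def PiE_iff
          extensional_def fun_eq_iff)
    show "(\<lambda>(\<kappa>, x). \<kappa>(v := x)) ` ?P \<subseteq> ?D"
    proof (rule image_subsetI)
      fix p assume "p \<in> ?P"
      then obtain \<kappa> x where p: "p = (\<kappa>, x)" and k: "\<kappa> \<in> ?C" and x: "x \<in> {..<q}" "x \<notin> \<kappa> ` S"
        by blast
      have "(\<kappa>(v := x)) a \<noteq> (\<kappa>(v := x)) b"
        if ab: "a \<in> insert v V" "b \<in> insert v V" "{a, b} \<in> E \<union> (\<lambda>s. {s, v}) ` S" for a b
        using that(3)
      proof
        assume "{a, b} \<in> E"
        moreover from this have "a \<in> V" "b \<in> V" using E by auto
        ultimately show ?thesis
          using k v by (auto simp: colorings_below_def proper_colorings_def)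
      next
        assume "{a, b} \<in> (\<lambda>s. {s, v}) ` S"
        then obtain s where "s \<in> S" "{a, b} = {s, v}" by auto
        then show ?thesis using x S v by (auto simp: doubleton_eq_iff)
      qed
      moreover have "\<kappa>(v := x) \<in> insert v V \<rightarrow>\<^sub>E UNIV"
        using k by (auto simp: colorings_below_def proper_colorings_def PiE_iff extensional_def)
      moreover have "(\<kappa>(v := x)) ` insert v V \<subseteq> {..<q}"
        using k x by (auto simp: colorings_below_def)
      moreover have "{v} \<notin> E" using E v by auto
      ultimately show "(\<lambda>(\<kappa>, x). \<kappa>(v := x)) p \<in> ?D"
        by (auto simp: colorings_below_def proper_colorings_def p simp del: fun_upd_apply)
    qed
    show "(\<lambda>\<kappa>. (restrict \<kappa> V, \<kappa> v)) ` ?D \<subseteq> ?P"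
    proof (rule image_subsetI)
      fix \<kappa> assume k: "\<kappa> \<in> ?D"
      have "restrict \<kappa> V \<in> ?C" "\<kappa> v < q"
        using k by (auto simp: colorings_below_def proper_colorings_def)
      moreover have "\<kappa> v \<noteq> restrict \<kappa> V s" if s: "s \<in> S" for s
      proof -
        have "{s, v} \<in> E \<union> (\<lambda>s. {s, v}) ` S" "s \<in> V" using s S by auto
        then have "\<kappa> s \<noteq> \<kappa> v" using k by (auto simp: colorings_below_def proper_colorings_def)
        with \<open>s \<in> V\<close> show ?thesis by simp
      qed
      ultimately show "(restrict \<kappa> V, \<kappa> v) \<in> ?P" by (auto simp del: restrict_apply)
    qed
  qed
  then have "card ?D = card ?P" by (simp add: bij_betw_same_card)
  also have "\<dots> = (\<Sum>\<kappa>\<in>?C. card ({..<q} - \<kappa> ` S))"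
    using V by (intro card_SigmaI) (auto intro: finite_colorings_below)
  \<comment> \<open>Truncated subtraction is exact here, since the colors on \<open>S\<close> all
    lie below \<open>q\<close>.\<close>
  also have "\<dots> = (\<Sum>\<kappa>\<in>?C. q - card (\<kappa> ` S))"
  proof (rule sum.cong[OF refl])
    fix \<kappa> assume "\<kappa> \<in> ?C"
    then have "\<kappa> ` S \<subseteq> {..<q}" using S by (auto simp: colorings_below_def)
    then show "card ({..<q} - \<kappa> ` S) = q - card (\<kappa> ` S)"
      by (simp add: card_Diff_subset finite_subset)
  qed
  finally show ?thesis .
qed

lemma card_colorings_below_add_leaf:
  assumes "finite V" "\<And>e. e \<in> E \<Longrightarrow> e \<subseteq> V" "v \<notin> V" "u \<in> V"
  shows "card (colorings_below q (insert v V, insert {u, v} E))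
      = card (colorings_below q (V, E)) * (q - 1)"
  using card_colorings_below_add_vertex[of V E v "{u}" q] assms by simp

lemma card_colorings_below_star_graph:
  "card (colorings_below q (star_graph (Suc k))) = q * (q - 1) ^ k"
proof (induction k)
  case 0
  have "card (colorings_below q (insert 0 {}, {} \<union> (\<lambda>s. {s, 0 :: nat}) ` {})) = q"
    by (subst card_colorings_below_add_vertex)
       (auto simp: colorings_below_def proper_colorings_def)
  moreover have "star_graph 1 = ({0}, {})" by (auto simp: star_graph_def)
  ultimately show ?case by simp
next
  case (Suc k)
  let ?G = "star_graph (Suc k)"
  have "star_graph (Suc (Suc k)) = (insert (Suc k) (verts ?G), insert {0, Suc k} (edges ?G))"
    by (auto simp: star_graph_def less_Suc_eq)
  moreover have "card (colorings_below q \<dots>)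
      = card (colorings_below q (verts ?G, edges ?G)) * (q - 1)"
    by (rule card_colorings_below_add_leaf) (auto simp: star_graph_def)
  ultimately show ?case using Suc by simp
qed

section \<open>Attaching paths, cycles and trees\<close>

lemma path_edges_singleton [simp]: "path_edges [x] = {}"
  by (auto simp: path_edges_def)

lemma path_edges_eq_image: "path_edges p = (\<lambda>i. {p ! i, p ! Suc i}) ` {i. Suc i < length p}"
  by (auto simp: path_edges_def)

lemma path_edges_snoc:
  assumes "p \<noteq> []"
  shows "path_edges (p @ [x]) = insert {last p, x} (path_edges p)"
proof -
  have "{i. Suc i < length (p @ [x])} = insert (length p - 1) {i. Suc i < length p}"
    using assms by (cases p) auto
  then show ?thesis
    using assms by (simp add: path_edges_eq_image nth_append last_conv_nth)
qed

lemma path_edges_Cons: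
  assumes "p \<noteq> []"
  shows "path_edges (x # p) = insert {x, hd p} (path_edges p)"
proof -
  have "i \<in> {i. Suc i < length (x # p)} \<longleftrightarrow> i \<in> insert 0 (Suc ` {i. Suc i < length p})" for i
    using assms by (cases i) auto
  then have "{i. Suc i < length (x # p)} = insert 0 (Suc ` {i. Suc i < length p})" by blast
  then show ?thesis
    using assms by (simp add: path_edges_eq_image hd_conv_nth image_image)
qed

lemma cycle_edges_eq:
  assumes "p \<noteq> []"
  shows "cycle_edges p = insert {last p, hd p} (path_edges p)"
proof -
  have "cycle_edges p = (\<lambda>i. {p ! i, p ! (Suc i mod length p)}) ` {..<length p}"
    by (auto simp: cycle_edges_def)
  also have "{..<length p} = insert (length p - 1) {i. Suc i < length p}"
    using assms by (cases p) auto
  finally show ?thesis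
    using assms by (simp add: path_edges_eq_image last_conv_nth hd_conv_nth)
qed

lemma path_edges_subset: "e \<in> path_edges p \<Longrightarrow> e \<subseteq> set p"
  by (auto simp: path_edges_def)

lemma cycle_edges_subset: "e \<in> cycle_edges p \<Longrightarrow> e \<subseteq> set p"
  by (auto simp: cycle_edges_def intro!: nth_mem mod_less_divisor)

lemma cycle_edges_rotate1: "cycle_edges (rotate1 p) = cycle_edges p"
proof (cases p)
  case (Cons x xs)
  then show ?thesis
    by (cases "xs = []") (auto simp: cycle_edges_eq path_edges_Cons path_edges_snoc insert_commute)
qed simp

lemma cycle_edges_rotate: "cycle_edges (rotate m p) = cycle_edges p"
  by (induction m) (simp_all add: cycle_edges_rotate1)

lemma cycle_starting_at:
  assumes "x \<in> set p" "distinct p"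
  obtains ps where "distinct (x # ps)" "set (x # ps) = set p"
    "length p = Suc (length ps)" "cycle_edges (x # ps) = cycle_edges p"
proof -
  obtain ys zs where p: "p = ys @ x # zs" using assms by (meson split_list)
  then have "rotate (length ys) p = x # zs @ ys" by (simp add: rotate_append)
  then have "cycle_edges (x # zs @ ys) = cycle_edges p" by (metis cycle_edges_rotate)
  with that[of "zs @ ys"] assms p show ?thesis by auto
qed

text \<open>Built from \<open>u\<close> outwards, the path gains each vertex as a leaf; hence the
  induction at the end of the list.\<close>

lemma card_colorings_below_add_path:
  assumes V: "finite V" and E: "\<And>e. e \<in> E \<Longrightarrow> e \<subseteq> V" and u: "u \<in> V"
    and "distinct ps" "set ps \<inter> V = {}"
  shows "card (colorings_below q (V \<union> set ps, E \<union> path_edges (u # ps)))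
      = card (colorings_below q (V, E)) * (q - 1) ^ length ps"
  using assms(4,5)
proof (induction ps rule: rev_induct)
  case (snoc d ps)
  have "path_edges (u # ps @ [d]) = insert {last (u # ps), d} (path_edges (u # ps))"
    using path_edges_snoc[of "u # ps" d] by simp
  moreover have "card (colorings_below q (insert d (V \<union> set ps),
      insert {last (u # ps), d} (E \<union> path_edges (u # ps))))
      = card (colorings_below q (V \<union> set ps, E \<union> path_edges (u # ps))) * (q - 1)"
  proof (rule card_colorings_below_add_leaf)
    show "last (u # ps) \<in> V \<union> set ps" using u by auto
    show "e \<subseteq> V \<union> set ps" if "e \<in> E \<union> path_edges (u # ps)" for e
      using that E path_edges_subset[of e "u # ps"] u by auto
  qed (use V snoc in auto)
  ultimately show ?case using snoc by simp
qed simp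

text \<open>
  The last vertex of the new path must avoid the colors of its predecessor and of \<open>u\<close>; these
  two colors differ exactly in the colorings of the cycle that is shorter by one vertex.  For
  \<open>ps = []\<close> the cycle is a loop, which admits no proper coloring.
\<close>

lemma card_colorings_below_add_cycle:
  assumes V: "finite V" and E: "\<And>e. e \<in> E \<Longrightarrow> e \<subseteq> V" and u: "u \<in> V" and q: "q \<ge> 2"
    and "distinct ps" "set ps \<inter> V = {}"
  shows "rat_of_nat q * of_nat (card (colorings_below q (V \<union> set ps, E \<union> cycle_edges (u # ps))))
      = of_nat (card (colorings_below q (V, E)))
        * ((of_nat q - 1) ^ Suc (length ps) + (- 1) ^ Suc (length ps) * (of_nat q - 1))"
  using assms(5,6)
proof (induction ps rule: rev_induct)
  case Nil
  have "colorings_below q (V, insert {u} E) = {}"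
    using u by (auto simp: colorings_below_def proper_colorings_def)
  then show ?case by (simp add: cycle_edges_eq)
next
  case (snoc d ps)
  \<comment> \<open>\<open>(W, F)\<close> carries the path \<open>u # ps\<close> without its closing
    edge; the new vertex \<open>d\<close> is joined to both ends \<open>l\<close> and
    \<open>u\<close>, which coincide for \<open>ps = []\<close>.\<close>
  define W where "W = V \<union> set ps"
  define F where "F = E \<union> path_edges (u # ps)"
  define l where "l = last (u # ps)"
  let ?C = "colorings_below q (W, F)"
  have W: "finite W" "u \<in> W" "l \<in> W" "d \<notin> W" using V u snoc by (auto simp: W_def l_def)
  have F: "e \<subseteq> W" if "e \<in> F" for e
    using that E path_edges_subset[of e "u # ps"] u by (auto simp: W_def F_def)
  have short: "E \<union> cycle_edges (u # ps) = insert {l, u} F"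
    by (simp add: cycle_edges_eq F_def l_def)
  have "E \<union> cycle_edges (u # ps @ [d]) = F \<union> (\<lambda>s. {s, d}) ` {l, u}"
    using path_edges_snoc[of "u # ps" d] by (auto simp: cycle_edges_eq F_def l_def)
  then have "card (colorings_below q (V \<union> set (ps @ [d]), E \<union> cycle_edges (u # ps @ [d])))
      = (\<Sum>\<kappa>\<in>?C. q - card (\<kappa> ` {l, u}))"
    using card_colorings_below_add_vertex[OF W(1) F W(4), where S = "{l, u}" and q = q] W by (simp add: W_def)
  \<comment> \<open>The vertices \<open>l\<close> and \<open>u\<close> use one or two colors;
    \<open>q \<ge> 2\<close> keeps the subtraction exact in both cases.\<close>
  also have "rat_of_nat \<dots> = (\<Sum>\<kappa>\<in>?C. (of_nat q - 1) - (if \<kappa> l \<noteq> \<kappa> u then 1 else 0))"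
    unfolding of_nat_sum using q
    by (intro sum.cong) (auto simp: of_nat_diff card_insert_if)
  also have "\<dots> = of_nat (card ?C) * (of_nat q - 1) - of_nat (card {\<kappa> \<in> ?C. \<kappa> l \<noteq> \<kappa> u})"
    using W(1) finite_colorings_below[of "(W, F)" q]
    by (simp add: sum_subtractf flip: sum.inter_filter)
  also have "card ?C = card (colorings_below q (V, E)) * (q - 1) ^ length ps"
    unfolding W_def F_def using snoc V E u by (intro card_colorings_below_add_path) auto
  also have "{\<kappa> \<in> ?C. \<kappa> l \<noteq> \<kappa> u} = colorings_below q (V \<union> set ps, E \<union> cycle_edges (u # ps))"
    unfolding short W_def[symmetric] using W
    by (auto simp: colorings_below_def proper_colorings_def doubleton_eq_iff)
  finally have "rat_of_nat (card (colorings_below q (V \<union> set (ps @ [d]), E \<union> cycle_edges (u # ps @ [d]))))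
      = of_nat (card (colorings_below q (V, E))) * (of_nat q - 1) ^ Suc (length ps)
      - of_nat (card (colorings_below q (V \<union> set ps, E \<union> cycle_edges (u # ps))))"
    using q by (simp add: of_nat_diff mult_ac)
  \<comment> \<open>The factor \<open>q\<close> makes the induction hypothesis for the shorter cycle
    applicable. The powers then combine by \<open>q z^m - z^m = z^(m + 1)\<close> with
    \<open>z = q - 1\<close> and \<open>m = Suc (length ps)\<close>.\<close>
  then have "rat_of_nat q * of_nat (card (colorings_below q (V \<union> set (ps @ [d]), E \<union> cycle_edges (u # ps @ [d]))))
      = of_nat q * of_nat (card (colorings_below q (V, E))) * (of_nat q - 1) ^ Suc (length ps)
      - of_nat (card (colorings_below q (V, E)))
        * ((of_nat q - 1) ^ Suc (length ps) + (- 1) ^ Suc (length ps) * (of_nat q - 1))"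
    using snoc by (simp add: right_diff_distrib mult.assoc)
  also have "\<dots> = of_nat (card (colorings_below q (V, E)))
        * ((of_nat q - 1) ^ Suc (length (ps @ [d])) + (- 1) ^ Suc (length (ps @ [d])) * (of_nat q - 1))"
    by (simp add: algebra_simps)
  finally show ?case by simp
qed

text \<open>
  A maximal subgraph of \<open>G\<close> that arises from \<open>H\<close> by adding leaves spans \<open>G\<close> by connectedness;
  the edge count then shows that it is all of \<open>G\<close>.
\<close>

lemma card_colorings_below_subgraph_same_excess:
  assumes G: "simple_graph G" "connected_graph G"
    and H: "subgraph H G" "verts H \<noteq> {}"
    and excess: "card (edges G) + card (verts H) = card (edges H) + card (verts G)"
  shows "card (colorings_below q G)
      = card (colorings_below q H) * (q - 1) ^ (card (verts G) - card (verts H))"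
proof -
  have finV: "finite (verts G)" using G by (simp add: simple_graph_def)
  have finE: "finite (edges G)"
    using G by (auto intro!: finite_subset[of _ "Pow (verts G)"] simp: simple_graph_def)
  have sH: "simple_graph H" "verts H \<subseteq> verts G" "edges H \<subseteq> edges G"
    using H by (auto simp: subgraph_def)
  \<comment> \<open>Invariant for growing \<open>H\<close> leaf by leaf: vertices and edges increase
    equally, and each leaf contributes a factor \<open>q - 1\<close>.\<close>
  have "\<exists>W F. verts H \<subseteq> W \<and> W \<subseteq> verts G \<and> F \<subseteq> edges G \<and> (\<forall>e\<in>F. e \<subseteq> W) \<and>
      card W = card (verts H) + k \<and> card F = card (edges H) + k \<and>
      card (colorings_below q (W, F)) = card (colorings_below q H) * (q - 1) ^ k"
    if "card (verts H) + k \<le> card (verts G)" for k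
    using that
  proof (induction k)
    case 0
    show ?case
      by (rule exI[of _ "verts H"], rule exI[of _ "edges H"])
         (use sH in \<open>auto simp: simple_graph_def\<close>)
  next
    case (Suc k)
    then obtain W F where WF: "verts H \<subseteq> W" "W \<subseteq> verts G" "F \<subseteq> edges G" "\<forall>e\<in>F. e \<subseteq> W"
      "card W = card (verts H) + k" "card F = card (edges H) + k"
      "card (colorings_below q (W, F)) = card (colorings_below q H) * (q - 1) ^ k"
      by auto
    have "W \<noteq> verts G" using WF(5) Suc.prems by auto
    then obtain b where b: "b \<in> verts G" "b \<notin> W" using WF by auto
    obtain a where a: "a \<in> W" "a \<in> verts G" using WF H by auto
    have "(a, b) \<in> {(x, y). {x, y} \<in> edges G}\<^sup>*"
      using G a b by (auto simp: connected_graph_def)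
    then have "\<exists>u v. u \<in> W \<and> v \<notin> W \<and> {u, v} \<in> edges G"
      using a(1) b(2)
    proof (induction rule: rtrancl_induct)
      case (step y z)
      then show ?case by (cases "y \<in> W") auto
    qed simp
    then obtain u v where uv: "u \<in> W" "v \<notin> W" "{u, v} \<in> edges G" by auto
    then have v: "v \<in> verts G" using G by (auto simp: simple_graph_def)
    have "{u, v} \<notin> F" using WF(4) uv by auto
    moreover have "finite F" "finite W"
      using WF finV finE finite_subset by blast+
    ultimately show ?case
      using WF uv v card_colorings_below_add_leaf[of W F v u q]
      by (intro exI[of _ "insert v W"] exI[of _ "insert {u, v} F"]) auto
  qed
  moreover have le: "card (verts H) \<le> card (verts G)"
    using sH finV by (intro card_mono) auto
  ultimately obtain W F where WF: "W \<subseteq> verts G" "F \<subseteq> edges G"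
      "card W = card (verts G)" "card F = card (edges H) + (card (verts G) - card (verts H))"
      "card (colorings_below q (W, F))
        = card (colorings_below q H) * (q - 1) ^ (card (verts G) - card (verts H))"
    by (metis le_add_diff_inverse order_refl)
  have "W = verts G" using WF finV by (intro card_subset_eq) auto
  \<comment> \<open>By \<open>excess\<close>, \<open>F\<close> has as many edges as
    \<open>G\<close>.\<close>
  moreover have "F = edges G" using WF finE excess le by (intro card_subset_eq) auto
  ultimately show ?thesis using WF by simp
qed

section \<open>Chromatic polynomials of two joined cycles and of type-I bicyclic graphs\<close>

lemma card_colorings_below_two_joined_cycles:
  assumes "two_joined_cycles s t H" and q: "q \<ge> 2"
  shows "rat_of_nat q * of_nat (card (colorings_below q H)) * (of_nat q - 1) ^ (s + t - 1)
      = ((of_nat q - 1) ^ s + (- 1) ^ s * (of_nat q - 1))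
      * ((of_nat q - 1) ^ t + (- 1) ^ t * (of_nat q - 1)) * (of_nat q - 1) ^ card (verts H)"
proof -
  obtain C D P where C: "distinct C" "length C = s" "s \<ge> 3"
    and D: "distinct D" "length D = t" "t \<ge> 3"
    and P: "distinct P" "length P \<ge> 1" "set P \<inter> set C = {hd P}" "set P \<inter> set D = {last P}"
    and CD: "set C \<inter> set D = (if length P = 1 then {hd P} else {})"
    and H: "verts H = set C \<union> set D \<union> set P"
      "edges H = cycle_edges C \<union> cycle_edges D \<union> path_edges P"
    using assms(1) unfolding two_joined_cycles_def by blast
  obtain u ps where Pu: "P = u # ps" using P(2) by (cases P) auto
  define w where "w = last P"
  have "u \<in> set C" "w \<in> set D" using P Pu by (auto simp: w_def)
  obtain cs where cs: "distinct (u # cs)" "set (u # cs) = set C" "length C = Suc (length cs)"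
      "cycle_edges (u # cs) = cycle_edges C"
    using cycle_starting_at[OF \<open>u \<in> set C\<close> C(1)] .
  obtain ds where ds: "distinct (w # ds)" "set (w # ds) = set D" "length D = Suc (length ds)"
      "cycle_edges (w # ds) = cycle_edges D"
    using cycle_starting_at[OF \<open>w \<in> set D\<close> D(1)] .
  have wP: "w \<in> set P" using Pu by (auto simp: w_def)
  \<comment> \<open>The cycles can meet only when the path is a single vertex; that vertex is
    \<open>u = w\<close>, which is absent from \<open>ds\<close>.\<close>
  have dsC: "set ds \<inter> set C = {}"
  proof -
    have "set ds \<inter> set C \<subseteq> (if length P = 1 then {u} else {})"
      using CD ds(2) Pu by auto
    moreover have "u = w" if "length P = 1" using that Pu by (auto simp: w_def)
    ultimately show ?thesis using ds(1) by (auto split: if_splits)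
  qed
  have dsP: "set ds \<inter> set P = {}" using P(4) ds(1,2) by (auto simp: w_def[symmetric])
  have psC: "set ps \<inter> set C = {}" using P(1,3) Pu by auto
  let ?V = "set C \<union> set ps" and ?E = "cycle_edges C \<union> path_edges P"
  let ?f = "\<lambda>k. (of_nat q - 1) ^ k + (- 1) ^ k * (of_nat q - 1) :: rat"
  let ?N = "\<lambda>V E. rat_of_nat (card (colorings_below q (V, E)))"
  have vH: "verts H = ?V \<union> set ds" using H ds(2) wP Pu \<open>u \<in> set C\<close> by auto
  have eH: "edges H = ?E \<union> cycle_edges (w # ds)" using H ds by auto
  have "card (set C \<union> set ps) = s + length ps"
    using C(1,2) P(1) Pu psC by (subst card_Un_disjoint) (auto simp: distinct_card)
  moreover have "set ds \<inter> (set C \<union> set ps) = {}" using dsC dsP Pu by auto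
  ultimately have cardH: "card (verts H) = s + length ps + (t - 1)"
    unfolding vH using ds D
    by (subst card_Un_disjoint) (auto simp: distinct_card)
  have one: "card (colorings_below q ({u}, {})) = q"
    using card_colorings_below_add_vertex[of "{}" "{}" u "{}" q]
    by (auto simp: colorings_below_def proper_colorings_def)
  \<comment> \<open>\<open>H\<close> is assembled from the single vertex \<open>u\<close>: first
    \<open>C\<close>, then the path, then \<open>D\<close> at \<open>w\<close>. The \<open>q\<close>
    colorings of \<open>u\<close> cancel the factor \<open>q\<close> that comes with
    \<open>C\<close>; the one that comes with \<open>D\<close> stays in the result.\<close>
  have "of_nat q * ?N ({u} \<union> set cs) ({} \<union> cycle_edges (u # cs))
      = ?N {u} {} * ?f (Suc (length cs))"
    using cs q by (intro card_colorings_below_add_cycle) auto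
  then have NC: "?N (set C) (cycle_edges C) = ?f s"
    using cs C q one by simp
  have "card (colorings_below q (set C \<union> set ps, cycle_edges C \<union> path_edges (u # ps)))
      = card (colorings_below q (set C, cycle_edges C)) * (q - 1) ^ length ps"
    using \<open>u \<in> set C\<close> P Pu psC cycle_edges_subset[of _ C] by (intro card_colorings_below_add_path) auto
  then have NP: "?N ?V ?E = ?f s * (of_nat q - 1) ^ length ps"
    using NC Pu q by (simp add: of_nat_diff)
  have "of_nat q * ?N (?V \<union> set ds) (?E \<union> cycle_edges (w # ds)) = ?N ?V ?E * ?f (Suc (length ds))"
  proof (rule card_colorings_below_add_cycle)
    show "w \<in> ?V" using wP Pu \<open>u \<in> set C\<close> by auto
    show "e \<subseteq> ?V" if "e \<in> ?E" for e
      using that cycle_edges_subset[of e C] path_edges_subset[of e P] Pu \<open>u \<in> set C\<close> by auto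
  qed (use q ds dsC dsP Pu in auto)
  then have "of_nat q * rat_of_nat (card (colorings_below q H))
      = ?f s * (of_nat q - 1) ^ length ps * ?f t"
    using NP ds D vH eH by (metis prod.collapse)
  \<comment> \<open>Two cycles glued at one vertex have \<open>s + t - 1\<close> vertices, and
    \<open>ps\<close> supplies the others. The extra power of \<open>q - 1\<close> thus turns the
    exponent \<open>length ps\<close> into \<open>card (verts H)\<close>.\<close>
  moreover have "card (verts H) = (s + t - 1) + length ps" using cardH D by simp
  ultimately show ?thesis
    by (simp add: power_add mult_ac)
qed

text \<open>\<open>G\<close> arises from its minimal bicyclic subgraph \<open>H\<close> by adding
  leaves, whose factors \<open>q - 1\<close> raise the exponent from \<open>card (verts H)\<close>
  to \<open>card (verts G)\<close>.\<close>

lemma card_colorings_below_bicyclic_type_I: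
  assumes "bicyclic_type_I s t G" and q: "q \<ge> 2"
  shows "rat_of_nat q * of_nat (card (colorings_below q G)) * (of_nat q - 1) ^ (s + t - 1)
      = ((of_nat q - 1) ^ s + (- 1) ^ s * (of_nat q - 1))
      * ((of_nat q - 1) ^ t + (- 1) ^ t * (of_nat q - 1)) * (of_nat q - 1) ^ card (verts G)"
proof -
  obtain H where G: "bicyclic G" and H: "subgraph H G" "bicyclic H" "two_joined_cycles s t H"
    using assms by (auto simp: bicyclic_type_I_def minimal_bicyclic_subgraph_def)
  have le: "card (verts H) \<le> card (verts G)"
    using G H(1) by (auto simp: subgraph_def bicyclic_def simple_graph_def intro: card_mono)
  let ?z = "rat_of_nat q - 1" and ?d = "card (verts G) - card (verts H)"
  have "card (colorings_below q G) = card (colorings_below q H) * (q - 1) ^ ?d"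
    using G H by (intro card_colorings_below_subgraph_same_excess)
      (auto simp: bicyclic_def connected_graph_def)
  then have "rat_of_nat q * of_nat (card (colorings_below q G)) * ?z ^ (s + t - 1)
      = (of_nat q * of_nat (card (colorings_below q H)) * ?z ^ (s + t - 1)) * ?z ^ ?d"
    using q by (simp add: of_nat_diff)
  also have "of_nat q * of_nat (card (colorings_below q H)) * ?z ^ (s + t - 1)
      = (?z ^ s + (- 1) ^ s * ?z) * (?z ^ t + (- 1) ^ t * ?z) * ?z ^ card (verts H)"
    by (rule card_colorings_below_two_joined_cycles[OF H(3) q])
  also have "\<dots> * ?z ^ ?d = (?z ^ s + (- 1) ^ s * ?z) * (?z ^ t + (- 1) ^ t * ?z)
      * (?z ^ card (verts H) * ?z ^ ?d)"
    by (simp only: mult.assoc)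
  also have "?z ^ card (verts H) * ?z ^ ?d = ?z ^ card (verts G)"
    using le by (simp flip: power_add)
  finally show ?thesis .
qed

section \<open>Specialization of finitely many variables\<close>

definition monomials_below :: "nat \<Rightarrow> nat \<Rightarrow> (nat \<Rightarrow>\<^sub>0 nat) set" where
  "monomials_below q k =
    {m. Poly_Mapping.keys m \<subseteq> {..<q} \<and> (\<Sum>i<q. Poly_Mapping.lookup m i) = k}"

lemma finite_monomials_below: "finite (monomials_below q k)"
proof -
  \<comment> \<open>The exponent vector of \<open>(x_0 ... x_(q-1))^k\<close>, which every monomial
    in question divides.\<close>
  define B where "B = (\<Sum>i<q. Poly_Mapping.single i k)"
  have lB: "Poly_Mapping.lookup B i = (if i < q then k else 0)" for i
    by (auto simp: B_def lookup_sum lookup_single when_def)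
  have "monomials_below q k \<subseteq> fst ` {(a, b). a + b = B}"
  proof
    fix m assume m: "m \<in> monomials_below q k"
    have "Poly_Mapping.lookup m i \<le> Poly_Mapping.lookup B i" for i
    proof (cases "i < q")
      case True
      then have "Poly_Mapping.lookup m i \<le> (\<Sum>i<q. Poly_Mapping.lookup m i)"
        by (intro member_le_sum) auto
      then show ?thesis using True m by (auto simp: lB monomials_below_def)
    next
      case False
      then have "i \<notin> Poly_Mapping.keys m" using m by (auto simp: monomials_below_def)
      then show ?thesis by (simp add: in_keys_iff)
    qed
    then have "m + (B - m) = B"
      by (intro poly_mapping_eqI) (simp add: lookup_add lookup_minus)
    then show "m \<in> fst ` {(a, b). a + b = B}" by force
  qed
  then show ?thesis by (rule finite_subset) (intro finite_imageI finite_splittings)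
qed

text \<open>The substitution \<open>x\<^sub>i \<mapsto> z\<close> for \<open>i < q\<close> and \<open>x\<^sub>i \<mapsto> 0\<close> for \<open>i \<ge> q\<close>.\<close>

definition specialize :: "nat \<Rightarrow> 'a :: comm_ring_1 mfps \<Rightarrow> 'a fps" where
  "specialize q f = Abs_fps (\<lambda>k. \<Sum>m\<in>monomials_below q k. coeff_mfps f m)"

lemma specialize_0 [simp]: "specialize q 0 = 0"
  by (rule fps_ext) (simp add: specialize_def zero_mfps.rep_eq)

lemma specialize_add: "specialize q (f + g) = specialize q f + specialize q g"
  by (rule fps_ext) (simp add: specialize_def plus_mfps.rep_eq sum.distrib)

lemma specialize_sum: "specialize q (\<Sum>x\<in>A. f x) = (\<Sum>x\<in>A. specialize q (f x))"
  by (induction A rule: infinite_finite_induct) (auto simp: specialize_add)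

lemma specialize_scale: "specialize q (scale_mfps c f) = fps_const c * specialize q f"
  by (rule fps_ext) (simp add: specialize_def scale_mfps.rep_eq sum_distrib_left)

lemma specialize_1 [simp]: "specialize q 1 = 1"
proof (rule fps_ext)
  fix k
  have "(\<Sum>m\<in>monomials_below q k. if m = 0 then 1 else 0 :: 'a)
      = (if 0 \<in> monomials_below q k then 1 else 0)"
    by (simp add: finite_monomials_below)
  then show "fps_nth (specialize q 1) k = fps_nth (1 :: 'a fps) k"
    by (auto simp: specialize_def one_mfps.rep_eq monomials_below_def)
qed

text \<open>Exponents never cancel, so a product of monomials involves only the first
  \<open>q\<close> variables exactly when both factors do. Degrees add, so the double sum can be
  regrouped by the degree of the first factor.\<close>

lemma specialize_mult: "specialize q (f * g) = specialize q f * specialize q g"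
proof (rule fps_ext)
  fix k
  let ?F = "\<lambda>(a, b). coeff_mfps f a * coeff_mfps g b"
  let ?M = "monomials_below q"
  have "fps_nth (specialize q (f * g)) k = (\<Sum>m\<in>?M k. \<Sum>p | fst p + snd p = m. ?F p)"
    by (simp add: specialize_def times_mfps.rep_eq case_prod_unfold)
  also have "\<dots> = (\<Sum>(m, p)\<in>(SIGMA m:?M k. {p. fst p + snd p = m}). ?F p)"
    using finite_splittings
    by (intro sum.Sigma) (auto simp: finite_monomials_below case_prod_unfold)
  also have "\<dots> = (\<Sum>(i, p)\<in>(SIGMA i:{0..k}. ?M i \<times> ?M (k - i)). ?F p)"
  proof (rule sum.reindex_bij_witness
      [where j = "\<lambda>(m, p). (\<Sum>i<q. Poly_Mapping.lookup (fst p) i, p)"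
         and i = "\<lambda>(i, p). (fst p + snd p, p)"], goal_cases)
    case (2 x)
    then show ?case
      by (auto simp: monomials_below_def lookup_add sum.distrib in_keys_iff subset_iff)
  next
    case (4 x)
    then show ?case
      by (auto simp: monomials_below_def lookup_add sum.distrib in_keys_iff subset_iff)
  qed (auto simp: monomials_below_def)
  also have "\<dots> = (\<Sum>i=0..k. \<Sum>p\<in>?M i \<times> ?M (k - i). ?F p)"
    by (rule sum.Sigma[symmetric]) (auto simp: finite_monomials_below)
  also have "\<dots> = fps_nth (specialize q f * specialize q g) k"
    by (simp add: specialize_def fps_mult_nth sum_product sum.cartesian_product)
  finally show "fps_nth (specialize q (f * g)) k = fps_nth (specialize q f * specialize q g) k" .
qed

text \<open>The monomial of a coloring has degree \<open>card (verts G)\<close> and survives the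
  substitution exactly when every color is below \<open>q\<close>.\<close>

lemma specialize_chromatic_symfun:
  assumes V: "finite (verts G)"
  shows "specialize q (chromatic_symfun G)
      = fps_const (of_nat (card (colorings_below q G))) * fps_X ^ card (verts G)"
proof (rule fps_ext)
  fix k
  define mon where "mon = (\<lambda>\<kappa>. \<Sum>v\<in>verts G. Poly_Mapping.single (\<kappa> v :: nat) (1 :: nat))"
  let ?S = "\<lambda>m. {\<kappa> \<in> proper_colorings G. mon \<kappa> = m}"
  have keys: "Poly_Mapping.keys (mon \<kappa>) = \<kappa> ` verts G" for \<kappa>
    using V by (auto simp: mon_def in_keys_iff lookup_sum lookup_single when_def split: if_splits)
  have deg: "(\<Sum>i<q. Poly_Mapping.lookup (mon \<kappa>) i) = card (verts G)"
    if "\<kappa> ` verts G \<subseteq> {..<q}" for \<kappa>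
  proof -
    have "(\<Sum>i<q. Poly_Mapping.lookup (mon \<kappa>) i)
        = (\<Sum>v\<in>verts G. \<Sum>i<q. if \<kappa> v = i then 1 else 0)"
      unfolding mon_def lookup_sum lookup_single when_def by (rule sum.swap)
    also have "\<dots> = (\<Sum>v\<in>verts G. 1)" using that by (intro sum.cong) auto
    finally show ?thesis by simp
  qed
  have below: "mon \<kappa> \<in> monomials_below q k \<longleftrightarrow> \<kappa> ` verts G \<subseteq> {..<q} \<and> k = card (verts G)" for \<kappa>
    using deg[of \<kappa>] by (auto simp only: monomials_below_def mem_Collect_eq keys)
  have fin: "finite (?S m)" for m
    unfolding mon_def using V by (rule finite_colorings_of_monomial)
  have "fps_nth (specialize q (chromatic_symfun G)) k
      = of_nat (\<Sum>m\<in>monomials_below q k. card (?S m))"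
    by (simp add: specialize_def chromatic_symfun.rep_eq mon_def)
  also have "(\<Sum>m\<in>monomials_below q k. card (?S m)) = card (\<Union>m\<in>monomials_below q k. ?S m)"
    using fin by (intro card_UN_disjoint[symmetric]) (auto simp: finite_monomials_below)
  also have "(\<Union>m\<in>monomials_below q k. ?S m) = {\<kappa> \<in> proper_colorings G. mon \<kappa> \<in> monomials_below q k}"
    by auto
  also have "\<dots> = (if k = card (verts G) then colorings_below q G else {})"
    unfolding below by (auto simp: colorings_below_def)
  finally show "fps_nth (specialize q (chromatic_symfun G)) k = fps_nth
      (fps_const (of_nat (card (colorings_below q G))) * fps_X ^ card (verts G)) k"
    by simp
qed

text \<open>A part \<open>k\<close> contributes \<open>q (q - 1)^(k - 1)\<close>, and the exponents
  \<open>k - 1\<close> add up to \<open>sum_mset \<mu> - size \<mu>\<close>. The inequality is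
  carried through the induction because it makes this subtraction exact.\<close>

lemma specialize_star_symfun_partition:
  assumes "0 \<notin># \<mu>" "q \<ge> 1"
  shows "specialize q (star_symfun_partition \<mu>)
      = fps_const (of_nat q ^ size \<mu> * (of_nat q - 1) ^ (sum_mset \<mu> - size \<mu>)) * fps_X ^ sum_mset \<mu>"
    and "size \<mu> \<le> sum_mset \<mu>"
  using assms(1)
proof (induction \<mu>)
  case empty
  {
    case 1
    show ?case by (simp add: star_symfun_partition_def)
  next
    case 2
    show ?case by simp
  }
next
  case (add k \<mu>)
  {
    case 1
    then obtain l where l: "k = Suc l" by (cases k) auto
    have "finite (verts (star_graph k))" "card (verts (star_graph k)) = k"
      by (simp_all add: star_graph_def)
    then have "specialize q (star_symfun k) = fps_const (of_nat (q * (q - 1) ^ l)) * fps_X ^ k"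
      using l by (simp add: star_symfun_def specialize_chromatic_symfun card_colorings_below_star_graph)
    moreover have "size \<mu> \<le> sum_mset \<mu>" using add.IH(2) 1 by simp
    then have "Suc l + sum_mset \<mu> - Suc (size \<mu>) = l + (sum_mset \<mu> - size \<mu>)" by simp
    ultimately show ?case
      using add.IH(1) 1 assms(2)
      by (simp add: l star_symfun_partition_def specialize_mult of_nat_diff power_add mult_ac
          flip: fps_const_mult)
  next
    case 2
    then show ?case using add.IH(2) by (cases k) auto
  }
qed

text \<open>Both sides of the expansion are specialized and compared in degree \<open>n\<close>.
  Since \<open>q - 1\<close> is nonzero, its power \<open>n - size \<mu>\<close> can be written as a
  quotient.\<close>

lemma star_expansion_card_colorings_below:
  assumes c: "star_expansion G c" and V: "finite (verts G)" "card (verts G) = n" and q: "q \<ge> 2"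
  shows "rat_of_nat (card (colorings_below q G))
      = (of_nat q - 1) ^ n
        * (\<Sum>\<mu>\<in>partitions_of n. c \<mu> * (of_nat q / (of_nat q - 1)) ^ size \<mu>)"
proof -
  have "specialize q (chromatic_symfun G)
      = (\<Sum>\<mu>\<in>partitions_of n. fps_const (c \<mu>) * specialize q (star_symfun_partition \<mu>))"
    using c V by (simp add: star_expansion_def specialize_sum specialize_scale)
  then have "fps_nth (specialize q (chromatic_symfun G)) n
      = (\<Sum>\<mu>\<in>partitions_of n. fps_nth (fps_const (c \<mu>) * specialize q (star_symfun_partition \<mu>)) n)"
    by (simp add: fps_sum_nth)
  also have "\<dots> = (\<Sum>\<mu>\<in>partitions_of n.
      (of_nat q - 1) ^ n * (c \<mu> * (of_nat q / (of_nat q - 1)) ^ size \<mu>))"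
  proof (rule sum.cong[OF refl])
    fix \<mu> assume "\<mu> \<in> partitions_of n"
    then have mu: "0 \<notin># \<mu>" "sum_mset \<mu> = n" by (auto simp: partitions_of_def)
    have "size \<mu> \<le> n" using specialize_star_symfun_partition(2)[of \<mu> q] mu q by simp
    moreover have "rat_of_nat q - 1 \<noteq> 0" using q by simp
    ultimately show "fps_nth (fps_const (c \<mu>) * specialize q (star_symfun_partition \<mu>)) n
        = (of_nat q - 1) ^ n * (c \<mu> * (of_nat q / (of_nat q - 1)) ^ size \<mu>)"
      using specialize_star_symfun_partition(1)[of \<mu> q] mu q
      by (simp add: power_diff power_divide)
  qed
  finally show ?thesis
    using V by (simp add: specialize_chromatic_symfun sum_distrib_left)
qed

section \<open>Binomial coefficient identities\<close>

lemma coeff_one_minus_X_power: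
  "coeff ([:1, - 1:] ^ m :: 'a :: comm_ring_1 poly) k = (- 1) ^ k * of_nat (m choose k)"
proof (induction m arbitrary: k)
  case 0
  then show ?case by (cases k) auto
next
  case (Suc m)
  then show ?case by (cases k) (auto simp: algebra_simps)
qed

text \<open>Vandermonde's identity with the extreme terms \<open>i = 0\<close> and
  \<open>i = j + 1\<close> moved to the left.\<close>

lemma choose_diff_eq_sum:
  fixes a b j :: nat
  assumes "j \<ge> 1"
  shows "of_nat ((a + b) choose (j + 1)) - of_nat (b choose (j + 1)) - of_nat (a choose (j + 1))
      = (\<Sum>i=1..j. of_nat (a choose i) * of_nat (b choose (j - i + 1)) :: rat)"
proof -
  have "(a + b) choose (j + 1) = (\<Sum>i\<le>Suc j. (a choose i) * (b choose (Suc j - i)))"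
    by (simp add: vandermonde)
  also have "\<dots> = (\<Sum>i=0..Suc j. (a choose i) * (b choose (Suc j - i)))"
    by (simp add: atMost_atLeast0)
  also have "\<dots> = (b choose Suc j) + (\<Sum>i=1..j. (a choose i) * (b choose (Suc j - i))) + (a choose Suc j)"
    by (simp add: sum.atLeast_Suc_atMost[of 0])
  also have "(\<Sum>i=1..j. (a choose i) * (b choose (Suc j - i)))
      = (\<Sum>i=1..j. (a choose i) * (b choose (j - i + 1)))"
    by (intro sum.cong) (auto simp: Suc_diff_le)
  finally show ?thesis by simp
qed

section \<open>Sums of star coefficients\<close>

theorem proposition7p4:
  fixes G :: "'v graph" and n s t :: nat and c :: "nat multiset \<Rightarrow> rat"
  assumes "bicyclic_type_I s t G"
    and "card (verts G) = n"
    and "3 \<le> s" and "s \<le> t"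
    and "star_expansion G c"
  shows "(\<forall>j\<ge>1.
      (\<Sum>\<mu> | \<mu> \<in> partitions_of n \<and> size \<mu> = j. c \<mu>)
        = (- 1) ^ (j - 1) * (\<Sum>i = 1..j. of_nat ((s - 1) choose i) * of_nat ((t - 1) choose (j - i + 1))) \<and>
      (\<Sum>\<mu> | \<mu> \<in> partitions_of n \<and> size \<mu> = j. c \<mu>)
        = (- 1) ^ (j - 1) * (of_nat ((s + t - 2) choose (j + 1))
            - of_nat ((t - 1) choose (j + 1)) - of_nat ((s - 1) choose (j + 1)))) \<and>
    (\<forall>j\<ge>s + t - 2. (\<Sum>\<mu> | \<mu> \<in> partitions_of n \<and> size \<mu> = j. c \<mu>) = 0) \<and>
    (\<forall>j. 1 \<le> j \<and> j \<le> s + t - 3 \<longrightarrow> (\<Sum>\<mu> | \<mu> \<in> partitions_of n \<and> size \<mu> = j. c \<mu>) \<noteq> 0)"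
proof -
  define a where "a j = (\<Sum>\<mu> | \<mu> \<in> partitions_of n \<and> size \<mu> = j. c \<mu>)" for j
  \<comment> \<open>\<open>A\<close> is the generating polynomial of the sums \<open>a j\<close>,
    and \<open>Q\<close> is what \<open>y A(y)\<close> will turn out to be. The factor
    \<open>y\<close> avoids a division and shifts \<open>a j\<close> to index
    \<open>j + 1\<close>.\<close>
  define A where "A = (\<Sum>\<mu>\<in>partitions_of n. monom (c \<mu>) (size \<mu>))"
  define Q :: "rat poly" where "Q = (1 - [:1, - 1:] ^ (s - 1)) * (1 - [:1, - 1:] ^ (t - 1))"
  have finV: "finite (verts G)"
    using assms(1) by (simp add: bicyclic_type_I_def bicyclic_def simple_graph_def)
  have coeff_A: "coeff A j = a j" for j
    by (simp add: A_def a_def coeff_sum finite_partitions_of flip: sum.inter_filter)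
  have eval: "poly (pCons 0 A) y = poly Q y"
    if y: "y = rat_of_nat q / (of_nat q - 1)" and q: "q \<ge> 2" for y q
  proof -
    define z where "z = rat_of_nat q - 1"
    have z: "z > 0" using q by (simp add: z_def)
    have "poly A y = (\<Sum>\<mu>\<in>partitions_of n. c \<mu> * y ^ size \<mu>)"
      by (simp add: A_def poly_sum poly_monom)
    then have N: "rat_of_nat (card (colorings_below q G)) = z ^ n * poly A y"
      using star_expansion_card_colorings_below[OF assms(5) finV assms(2) q] y by (simp add: z_def)
    have "of_nat q * (z ^ n * poly A y) * z ^ (s + t - 1)
        = (z ^ s + (- 1) ^ s * z) * (z ^ t + (- 1) ^ t * z) * z ^ n"
      using card_colorings_below_bicyclic_type_I[OF assms(1) q] assms(2) N by (simp add: z_def)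
    then have *: "of_nat q * poly A y * z ^ (s + t - 1)
        = (z ^ s + (- 1) ^ s * z) * (z ^ t + (- 1) ^ t * z)"
      using z by (simp add: mult_ac)
    \<comment> \<open>Here \<open>1 - y = -1/z\<close>, hence
      \<open>z^k (1 - y)^(k - 1) = (-1)^(k - 1) z\<close>.\<close>
    have f: "z ^ k + (- 1) ^ k * z = z ^ k * (1 - (1 - y) ^ (k - 1))" if k: "k \<ge> 3" for k
    proof -
      obtain l where l: "k = Suc l" using k by (cases k) auto
      have "1 - y = - 1 / z" using z y by (simp add: z_def field_simps)
      then have "z ^ l * (1 - y) ^ l = (- 1) ^ l" using z by (simp flip: power_mult_distrib)
      then show ?thesis by (simp add: l algebra_simps)
    qed
    \<comment> \<open>The cycle factors supply one power of \<open>z\<close> more than the left side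
      has; it cancels later against \<open>q = z y\<close>.\<close>
    have "z ^ s * z ^ t = z * z ^ (s + t - 1)"
      using assms(3) by (simp flip: power_add power_Suc)
    then have "z ^ (s + t - 1) * (of_nat q * poly A y)
        = z ^ (s + t - 1) * (z * ((1 - (1 - y) ^ (s - 1)) * (1 - (1 - y) ^ (t - 1))))"
      using * f[of s] f[of t] assms(3,4) by (simp add: mult_ac)
    then have "of_nat q * poly A y = z * ((1 - (1 - y) ^ (s - 1)) * (1 - (1 - y) ^ (t - 1)))"
      using z by simp
    then have "y * poly A y = (1 - (1 - y) ^ (s - 1)) * (1 - (1 - y) ^ (t - 1))"
    proof -
      have "of_nat q = z * y" using z y by (simp add: z_def)
      with \<open>of_nat q * poly A y = _\<close> show ?thesis using z by (simp add: mult.assoc)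
    qed
    then show ?thesis by (simp add: Q_def)
  qed
  \<comment> \<open>The map \<open>q \<mapsto> q / (q - 1)\<close> is injective on
    \<open>q \<ge> 2\<close>, so the two polynomials agree at infinitely many points.\<close>
  have "pCons 0 A = Q"
  proof (rule ccontr)
    assume "pCons 0 A \<noteq> Q"
    then have "finite {y. poly (pCons 0 A - Q) y = 0}" by (intro poly_roots_finite) simp
    moreover have "(\<lambda>q. rat_of_nat q / (of_nat q - 1)) ` {2..} \<subseteq> {y. poly (pCons 0 A - Q) y = 0}"
      using eval by auto
    ultimately have "finite ((\<lambda>q. rat_of_nat q / (of_nat q - 1)) ` {2..})"
      by (rule rev_finite_subset)
    moreover have "inj_on (\<lambda>q. rat_of_nat q / (of_nat q - 1)) {2..}"
      by (auto intro!: inj_onI simp: field_simps)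
    ultimately show False using finite_imageD infinite_Ici by blast
  qed
  then have "coeff (pCons 0 A) (Suc j) = coeff Q (Suc j)" for j by simp
  then have "a j = coeff Q (Suc j)" for j using coeff_A by simp
  moreover have "Q = 1 - [:1, - 1:] ^ (s - 1) - [:1, - 1:] ^ (t - 1) + [:1, - 1:] ^ (s + t - 2)"
  proof -
    have "s + t - 2 = (s - 1) + (t - 1)" using assms by simp
    then show ?thesis by (simp add: Q_def algebra_simps power_add)
  qed
  \<comment> \<open>The summand \<open>1\<close> of \<open>Q\<close> affects only index
    \<open>0\<close>, never \<open>Suc j\<close>.\<close>
  ultimately have a_Suc: "a j = (- 1) ^ Suc j * (of_nat ((s + t - 2) choose Suc j)
      - of_nat ((t - 1) choose Suc j) - of_nat ((s - 1) choose Suc j))" for j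
    by (simp add: coeff_one_minus_X_power right_diff_distrib)
  have a: "a j = (- 1) ^ (j - 1) * (of_nat ((s + t - 2) choose (j + 1))
      - of_nat ((t - 1) choose (j + 1)) - of_nat ((s - 1) choose (j + 1)))" if "j \<ge> 1" for j
    using that by (cases j) (simp_all add: a_Suc)
  have st: "(s - 1) + (t - 1) = s + t - 2" using assms by simp
  have a': "a j = (- 1) ^ (j - 1)
      * (\<Sum>i = 1..j. of_nat ((s - 1) choose i) * of_nat ((t - 1) choose (j - i + 1)))"
    if "j \<ge> 1" for j
    using a[OF that] choose_diff_eq_sum[OF that, of "s - 1" "t - 1"] st by simp
  \<comment> \<open>Now \<open>j + 1\<close> exceeds \<open>s + t - 2\<close>, hence also
    \<open>s - 1\<close> and \<open>t - 1\<close>, and all three binomials vanish.\<close>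
  have zero: "a j = 0" if "j \<ge> s + t - 2" for j
    using a[of j] that assms by (simp add: binomial_eq_0)
  have nonzero: "a j \<noteq> 0" if j: "1 \<le> j" "j \<le> s + t - 3" for j
  proof -
    let ?g = "\<lambda>i. rat_of_nat ((s - 1) choose i) * of_nat ((t - 1) choose (j - i + 1))"
    \<comment> \<open>All summands are nonnegative, so one positive summand suffices. The largest
      admissible \<open>i\<close> makes \<open>j - i + 1\<close> smallest: it is \<open>1\<close>
      for \<open>i = j\<close>, and at most \<open>t - 1\<close> for \<open>i = s - 1\<close>
      because \<open>j \<le> s + t - 3\<close>.\<close>
    define i where "i = min j (s - 1)"
    have i: "i \<in> {1..j}" "i \<le> s - 1" "j - i + 1 \<le> t - 1"
      using j assms by (auto simp: i_def min_def)
    then have "0 < ?g i" by simp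
    also have "\<dots> \<le> (\<Sum>i=1..j. ?g i)" using i by (intro member_le_sum) auto
    finally show ?thesis using a'[OF j(1)] by simp
  qed
  show ?thesis using a a' zero nonzero unfolding a_def by blast
qed

end
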